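(* Let $\nu\in(0,1)$, let $N\ge 1$ be an integer, and let $y_1,\dots,y_N$ be points with $-1<y_1<\cdots<y_{N-1}<y_N\le 1$. Let $u$ be a real function on $[-1,1]$ with $u(-1)=0$ whose left-sided Riemann-Liouville derivative ${}^{RL}_{-1}\mathcal{D}^{\nu}_x u$ is defined at the points $y_1,\dots,y_N$. Consider the Riemann-Liouville $\nu$-fractional Birkhoff interpolation problem: find $p\in\mathbb{S}^{\nu}_N$ such that $${}^{RL}_{-1}\mathcal{D}^{\nu}_x p(y_j)={}^{RL}_{-1}\mathcal{D}^{\nu}_x u(y_j),\qquad j=1,\dots,N.$$ Then the interpolant $u_N^\nu$ of $u$ (that is, the solution $p=u_N^\nu$ of this problem) takes the form $$u_N^\nu(x)=\sum_{j=1}^{N}\left({}^{RL}_{-1}\mathcal{D}^{\nu}_x u(y_j)\right)B_j^\nu(x),$$ where $$B_j^\nu(x)=(x+1)^\nu\sum_{n=1}^N\widetilde\alpha_{nj}\,P_{n-1}^{(-\nu,\nu)}(x),\qquad j=1,\dots,N,$$ with the coefficients $\widetilde\alpha_{nj}$ satisfying $$\sum_{n=1}^N\widetilde\alpha_{nj}\,\frac{\Gamma(n+\nu)}{\Gamma(n)}\,P_{n-1}(y_i)=\delta_{ij},\qquad i,j=1,\dots,N.$$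
   Context: For $\nu\in(0,1)$ the left-sided Riemann-Liouville fractional derivative of order $\nu$ on $[-1,1]$ is $${}^{RL}_{-1}\mathcal{D}^{\nu}_x u(x)=\frac{1}{\Gamma(1-\nu)}\frac{d}{dx}\int_{-1}^x\frac{u(\xi)}{(x-\xi)^{\nu}}\,d\xi .$$ $\mathbb{P}_n$ is the set of all (real) algebraic polynomials of degree at most $n$, and $\mathbb{S}^{\nu}_N=(x+1)^\nu\,\mathbb{P}_{N-1}=\{(x+1)^\nu q(x): q\in\mathbb{P}_{N-1}\}$. $P_n^{(\alpha,\beta)}$ denotes the standard Jacobi polynomial of degree $n$ (normalized by $P_n^{(\alpha,\beta)}(1)=\frac{\Gamma(n+\alpha+1)}{n!\,\Gamma(\alpha+1)}$), and $P_n=P_n^{(0,0)}$ denotes the Legendre polynomial of degree $n$. $\delta_{ij}$ is the Kronecker delta. *)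

theory Defs
  imports "HOL-Analysis.Analysis" "HOL-Computational_Algebra.Polynomial"
begin

text \<open>Functions on $[-1,1]$ are represented by functions of type \<open>real \<Rightarrow> real\<close> of which only the
  values on \<open>{-1..1}\<close> matter. The integrals are Lebesgue integrals.\<close>

definition rl_integral :: "real \<Rightarrow> (real \<Rightarrow> real) \<Rightarrow> real \<Rightarrow> real" where
  "rl_integral \<nu> u x = (LINT \<xi>:{-1..x}|lebesgue. u \<xi> / (x - \<xi>) powr \<nu>)"

text \<open>The derivative is taken within \<open>{-1..1}\<close>, so it is the left-hand derivative at the
  endpoint \<open>1\<close> and the ordinary one in the interior.\<close>

definition rl_deriv :: "real \<Rightarrow> (real \<Rightarrow> real) \<Rightarrow> real \<Rightarrow> real" where
  "rl_deriv \<nu> u x = 1 / Gamma (1 - \<nu>) * vector_derivative (rl_integral \<nu> u) (at x within {-1..1})"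

text \<open>Both \<open>LINT\<close> and \<open>vector_derivative\<close> are total, so \<open>rl_deriv \<nu> u x\<close> is meaningful only
  under the following condition, which says that the derivative is defined at \<open>x\<close>.\<close>

definition rl_differentiable :: "real \<Rightarrow> (real \<Rightarrow> real) \<Rightarrow> real \<Rightarrow> bool" where
  "rl_differentiable \<nu> u x \<longleftrightarrow>
     (\<forall>\<^sub>F t in nhds x. t \<in> {-1..1} \<longrightarrow>
        set_integrable lebesgue {-1..t} (\<lambda>\<xi>. u \<xi> / (t - \<xi>) powr \<nu>)) \<and>
     rl_integral \<nu> u differentiable (at x within {-1..1})"

text \<open>Explicit form of the Jacobi polynomials, valid for all real parameters:
  $P_n^{(\alpha,\beta)}(x) = \sum_{s=0}^n {n+\alpha \choose n-s} {n+\beta \choose s}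
   \left(\frac{x-1}{2}\right)^s \left(\frac{x+1}{2}\right)^{n-s}$.\<close>

definition jacobi :: "real \<Rightarrow> real \<Rightarrow> nat \<Rightarrow> real poly" where
  "jacobi \<alpha> \<beta> n = (\<Sum>s\<le>n. smult (((real n + \<alpha>) gchoose (n - s)) * ((real n + \<beta>) gchoose s))
                           ([:- 1/2, 1/2:] ^ s * [:1/2, 1/2:] ^ (n - s)))"

abbreviation legendre :: "nat \<Rightarrow> real poly" where
  "legendre n \<equiv> jacobi 0 0 n"

lemma jacobi_at_1:
  assumes "\<alpha> > -1"
  shows "poly (jacobi \<alpha> \<beta> n) 1 = Gamma (real n + \<alpha> + 1) / (fact n * Gamma (\<alpha> + 1))"
proof -
  have nz: "\<alpha> + 1 \<notin> \<int>\<^sub>\<le>\<^sub>0"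
    using assms by (auto elim!: nonpos_Ints_cases)
  have "poly (jacobi \<alpha> \<beta> n) 1 =
      (\<Sum>s\<le>n. ((real n + \<alpha>) gchoose (n - s)) * ((real n + \<beta>) gchoose s) * 0 ^ s)"
    by (simp add: jacobi_def poly_sum)
  also have "\<dots> = (\<Sum>s\<le>n. if s = 0 then (real n + \<alpha>) gchoose n else 0)"
    by (intro sum.cong) auto
  also have "\<dots> = (real n + \<alpha>) gchoose n"
    by simp
  also have "\<dots> = pochhammer (\<alpha> + 1) n / fact n"
    by (simp add: gbinomial_pochhammer')
  also have "\<dots> = Gamma (real n + \<alpha> + 1) / (fact n * Gamma (\<alpha> + 1))"
    using pochhammer_Gamma[OF nz, of n] by (simp add: add_ac field_simps)
  finally show ?thesis .
qed

text \<open>$(x+1)^\nu\,\mathbb{P}_{N-1}$ as functions on $[-1,1]$ (for \<open>N \<ge> 1\<close>).\<close>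

definition frac_poly_space :: "real \<Rightarrow> nat \<Rightarrow> (real \<Rightarrow> real) set" where
  "frac_poly_space \<nu> N =
     {p. \<exists>q :: real poly. degree q \<le> N - 1 \<and> (\<forall>x\<in>{-1..1}. p x = (x + 1) powr \<nu> * poly q x)}"

definition is_rl_interpolant ::
    "real \<Rightarrow> nat \<Rightarrow> (nat \<Rightarrow> real) \<Rightarrow> (real \<Rightarrow> real) \<Rightarrow> (real \<Rightarrow> real) \<Rightarrow> bool" where
  "is_rl_interpolant \<nu> N y u p \<longleftrightarrow>
     p \<in> frac_poly_space \<nu> N \<and>
     (\<forall>j\<in>{1..N}. rl_differentiable \<nu> p (y j) \<and> rl_deriv \<nu> p (y j) = rl_deriv \<nu> u (y j))"

definition birkhoff_coeffs :: "real \<Rightarrow> nat \<Rightarrow> (nat \<Rightarrow> real) \<Rightarrow> (nat \<Rightarrow> nat \<Rightarrow> real) \<Rightarrow> bool" where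
  "birkhoff_coeffs \<nu> N y a \<longleftrightarrow>
     (\<forall>i\<in>{1..N}. \<forall>j\<in>{1..N}.
        (\<Sum>n=1..N. a n j * (Gamma (real n + \<nu>) / Gamma (real n)) * poly (legendre (n - 1)) (y i))
          = (if i = j then 1 else 0))"

definition birkhoff_basis ::
    "real \<Rightarrow> nat \<Rightarrow> (nat \<Rightarrow> nat \<Rightarrow> real) \<Rightarrow> nat \<Rightarrow> real \<Rightarrow> real" where
  "birkhoff_basis \<nu> N a j x =
     (x + 1) powr \<nu> * (\<Sum>n=1..N. a n j * poly (jacobi (- \<nu>) \<nu> (n - 1)) x)"

end

theory Submission
  imports Defs
begin

text \<open>By the Beta integral, the fractional derivative maps \<open>(x + 1) powr (\<nu> + k)\<close> to
  \<open>\<Gamma>(\<nu> + k + 1) / k! (x + 1) ^ k\<close>. So on \<open>(x + 1) powr \<nu> * q\<close> it acts as an injective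
  diagonal map on the coefficients of \<open>q\<close> in powers of \<open>x + 1\<close>, and comparing the expansions at
  \<open>-1\<close> it maps \<open>(x + 1) powr \<nu> * P\<^sub>n\<^sup>(\<^sup>-\<^sup>\<nu>\<^sup>,\<^sup>\<nu>\<^sup>)\<close> to \<open>\<Gamma>(n + 1 + \<nu>) / n! P\<^sub>n\<close>. The problem
  thus becomes ordinary polynomial interpolation at \<open>N\<close> distinct points, with the Legendre
  polynomials as basis.\<close>

section \<open>Fractional derivatives of fractional polynomials\<close>

text \<open>The substitution \<open>t = (\<xi> + 1) / (x + 1)\<close> turns this into the integral
  of \<open>Beta (\<nu> + k + 1) (1 - \<nu>)\<close>. The powers of \<open>x + 1\<close> collect to
  \<open>(\<nu> + k) - \<nu> + 1 = k + 1\<close>, and the arguments of Beta add up to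
  \<open>k + 2\<close>, whence \<open>fact (Suc k)\<close>.\<close>

lemma has_integral_rl_monomial:
  fixes \<nu> x :: real
  assumes "0 < \<nu>" "\<nu> < 1" "-1 < x"
  shows "((\<lambda>\<xi>. (\<xi> + 1) powr \<nu> * (\<xi> + 1) ^ k / (x - \<xi>) powr \<nu>) has_integral
           Gamma (\<nu> + real k + 1) * Gamma (1 - \<nu>) / fact (Suc k) * (x + 1) ^ Suc k) {-1..x}"
proof -
  \<comment> \<open>The affine map \<open>\<xi> \<mapsto> m * \<xi> + m\<close> takes
    \<open>{-1..x}\<close> onto \<open>{0..1}\<close>; its slope and its shift are both
    \<open>m\<close>.\<close>
  define m where "m = 1 / (x + 1)"
  have m: "m > 0" using assms by (simp add: m_def)
  have "((\<lambda>t. t powr ((\<nu> + real k + 1) - 1) * (1 - t) powr ((1 - \<nu>) - 1)) has_integral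
          Beta (\<nu> + real k + 1) (1 - \<nu>)) (cbox 0 1)"
    using has_integral_Beta_real[of "\<nu> + real k + 1" "1 - \<nu>"] assms by simp
  note h = has_integral_affinity'[OF this m, of m]
  have "((\<lambda>\<xi>. (m * \<xi> + m) powr (\<nu> + real k) * (1 - (m * \<xi> + m)) powr (- \<nu>)) has_integral
          Beta (\<nu> + real k + 1) (1 - \<nu>) * (x + 1)) {-1..x}"
  proof -
    have "(0 - m) /\<^sub>R m = -1" "(1 - m) /\<^sub>R m = x"
         "Beta (\<nu> + real k + 1) (1 - \<nu>) /\<^sub>R m ^ DIM(real) =
            Beta (\<nu> + real k + 1) (1 - \<nu>) * (x + 1)"
      using assms by (simp_all add: m_def field_simps)
    moreover have "\<nu> + real k + 1 - 1 = \<nu> + real k" "1 - \<nu> - 1 = - \<nu>" by simp_all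
    ultimately show ?thesis using h by (simp only: real_scaleR_def cbox_interval)
  qed
  \<comment> \<open>The two rescaled powers carry \<open>(x + 1) powr (- \<nu> - k)\<close> and
    \<open>(x + 1) powr \<nu>\<close>, so exactly \<open>(x + 1) ^ k\<close> remains to be
    compensated.\<close>
  from has_integral_mult_left[OF this, of "(x + 1) ^ k"]
  have *: "((\<lambda>\<xi>. (m * \<xi> + m) powr (\<nu> + real k) * (1 - (m * \<xi> + m)) powr (- \<nu>) * (x + 1) ^ k)
          has_integral Beta (\<nu> + real k + 1) (1 - \<nu>) * (x + 1) ^ Suc k) {-1..x}"
    by (simp add: mult_ac)
  have B: "Beta (\<nu> + real k + 1) (1 - \<nu>) = Gamma (\<nu> + real k + 1) * Gamma (1 - \<nu>) / fact (Suc k)"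
    unfolding Beta_def using Gamma_fact[of "Suc k", where 'a = real] by (simp add: add_ac)
  have eq: "(m * \<xi> + m) powr (\<nu> + real k) * (1 - (m * \<xi> + m)) powr (- \<nu>) * (x + 1) ^ k =
      (\<xi> + 1) powr \<nu> * (\<xi> + 1) ^ k / (x - \<xi>) powr \<nu>" if "\<xi> \<in> {-1..x}" for \<xi>
  proof -
    have a: "m * \<xi> + m = (\<xi> + 1) / (x + 1)" "1 - (m * \<xi> + m) = (x - \<xi>) / (x + 1)"
      using assms by (simp_all add: m_def field_simps)
    show ?thesis
    \<comment> \<open>\<open>powr_realpow\<close> needs a positive base. At
      \<open>\<xi> = -1\<close> both sides are 0; at \<open>\<xi> = x\<close> they are 0 as well,
      since \<open>0 powr a = 0\<close> and division by 0 gives 0.\<close>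
    proof (cases "\<xi> = -1")
      case True
      then show ?thesis using assms a by simp
    next
      case False
      with that have "\<xi> > -1" by auto
      then show ?thesis
        unfolding a using assms that
        by (simp add: powr_divide powr_add powr_realpow powr_minus field_simps)
    qed
  qed
  show ?thesis
    using has_integral_eq[OF eq *] by (simp only: B)
qed

text \<open>Linearity reduces this to monomials. Integrability is stated separately because
  \<open>rl_differentiable\<close> demands it at all nearby points.\<close>

lemma rl_integral_frac_poly:
  fixes \<nu> t :: real and c :: "nat \<Rightarrow> real"
  assumes "0 < \<nu>" "\<nu> < 1" and t: "t \<in> {-1..1}"
    and p: "\<And>x. x \<in> {-1..1} \<Longrightarrow> p x = (x + 1) powr \<nu> * (\<Sum>k<N. c k * (x + 1) ^ k)"
  shows "set_integrable lebesgue {-1..t} (\<lambda>\<xi>. p \<xi> / (t - \<xi>) powr \<nu>)"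
    and "rl_integral \<nu> p t = Gamma (1 - \<nu>) *
           (\<Sum>k<N. c k * (Gamma (\<nu> + real k + 1) / fact (Suc k)) * (t + 1) ^ Suc k)"
proof -
  define g where "g k \<xi> = (\<xi> + 1) powr \<nu> * (\<xi> + 1) ^ k / (t - \<xi>) powr \<nu>" for k \<xi>
  have g: "(g k has_integral
      Gamma (\<nu> + real k + 1) * Gamma (1 - \<nu>) / fact (Suc k) * (t + 1) ^ Suc k) {-1..t}" for k
  \<comment> \<open>For \<open>t = -1\<close> the interval is a point, and the exponent
    \<open>Suc k\<close> makes the claimed value 0.\<close>
  proof (cases "t = -1")
    case True
    then show ?thesis using has_integral_refl(2)[of "g k" "-1"] by simp
  next
    case False
    then show ?thesis
      unfolding g_def using t by (intro has_integral_rl_monomial assms) auto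
  qed
  \<comment> \<open>Since \<open>g k\<close> is nonnegative, its gauge integrability is already
    absolute, so the Lebesgue integral has the same value.\<close>
  have "g k absolutely_integrable_on {-1..t}" for k
    using g[of k] by (intro nonnegative_absolutely_integrable_1) (auto simp: g_def)
  then have abs: "(\<lambda>\<xi>. \<Sum>k<N. c k * g k \<xi>) absolutely_integrable_on {-1..t}"
    by (intro absolutely_integrable_sum set_integrable_mult_right) auto
  have pg: "p \<xi> / (t - \<xi>) powr \<nu> = (\<Sum>k<N. c k * g k \<xi>)" if "\<xi> \<in> {-1..t}" for \<xi>
    using p[of \<xi>] that t by (simp add: g_def sum_distrib_left sum_divide_distrib mult_ac)
  show "set_integrable lebesgue {-1..t} (\<lambda>\<xi>. p \<xi> / (t - \<xi>) powr \<nu>)"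
    using abs by (subst set_integrable_cong[OF refl refl pg])
  have "rl_integral \<nu> p t = (LINT \<xi>:{-1..t}|lebesgue. \<Sum>k<N. c k * g k \<xi>)"
    unfolding rl_integral_def by (intro set_lebesgue_integral_cong) (use pg in auto)
  also have "\<dots> = integral {-1..t} (\<lambda>\<xi>. \<Sum>k<N. c k * g k \<xi>)"
    by (rule set_lebesgue_integral_eq_integral[OF abs])
  also have "\<dots> = (\<Sum>k<N. c k *
      (Gamma (\<nu> + real k + 1) * Gamma (1 - \<nu>) / fact (Suc k) * (t + 1) ^ Suc k))"
    by (intro integral_unique has_integral_sum has_integral_mult_right g) auto
  finally show "rl_integral \<nu> p t = Gamma (1 - \<nu>) *
           (\<Sum>k<N. c k * (Gamma (\<nu> + real k + 1) / fact (Suc k)) * (t + 1) ^ Suc k)"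
    by (simp add: sum_distrib_left mult_ac)
qed

text \<open>Differentiating \<open>(t + 1) ^ Suc k\<close> yields the factor \<open>k + 1\<close>
  that reduces \<open>fact (Suc k)\<close> to \<open>fact k\<close>, and
  \<open>Gamma (1 - \<nu>)\<close> cancels. The operator is thus diagonal in powers of
  \<open>x + 1\<close>.\<close>

lemma rl_deriv_frac_poly:
  fixes \<nu> x :: real and c :: "nat \<Rightarrow> real"
  assumes "0 < \<nu>" "\<nu> < 1" and x: "x \<in> {-1..1}"
    and p: "\<And>x. x \<in> {-1..1} \<Longrightarrow> p x = (x + 1) powr \<nu> * (\<Sum>k<N. c k * (x + 1) ^ k)"
  shows "rl_differentiable \<nu> p x"
    and "rl_deriv \<nu> p x = (\<Sum>k<N. c k * (Gamma (\<nu> + real k + 1) / fact k) * (x + 1) ^ k)"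
proof -
  let ?D = "Gamma (1 - \<nu>) * (\<Sum>k<N. c k * (Gamma (\<nu> + real k + 1) / fact k) * (x + 1) ^ k)"
  have "((\<lambda>t. Gamma (1 - \<nu>) *
           (\<Sum>k<N. c k * (Gamma (\<nu> + real k + 1) / fact (Suc k)) * (t + 1) ^ Suc k))
      has_real_derivative Gamma (1 - \<nu>) *
           (\<Sum>k<N. c k * (Gamma (\<nu> + real k + 1) / fact (Suc k)) * (real (Suc k) * (x + 1) ^ k)))
      (at x within {-1..1})"
    by (intro DERIV_cmult DERIV_sum) (auto intro!: derivative_eq_intros simp del: power_Suc)
  also have "(\<Sum>k<N. c k * (Gamma (\<nu> + real k + 1) / fact (Suc k)) * (real (Suc k) * (x + 1) ^ k)) =
      (\<Sum>k<N. c k * (Gamma (\<nu> + real k + 1) / fact k) * (x + 1) ^ k)"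
    by (intro sum.cong refl) (simp add: divide_simps del: of_nat_Suc)
  finally have "((\<lambda>t. Gamma (1 - \<nu>) *
           (\<Sum>k<N. c k * (Gamma (\<nu> + real k + 1) / fact (Suc k)) * (t + 1) ^ Suc k))
      has_vector_derivative ?D) (at x within {-1..1})"
    by (simp only: has_real_derivative_iff_has_vector_derivative)
  \<comment> \<open>The closed formula for the integral is known only on \<open>{-1..1}\<close>,
    which suffices for a derivative within that interval, endpoints included.\<close>
  then have D: "(rl_integral \<nu> p has_vector_derivative ?D) (at x within {-1..1})"
    using rl_integral_frac_poly(2)[OF assms(1,2) _ p]
    by (intro has_vector_derivative_transform[OF x, of "rl_integral \<nu> p"]) auto
  then show "rl_differentiable \<nu> p x"
    unfolding rl_differentiable_def
    using rl_integral_frac_poly(1)[OF assms(1,2) _ p] differentiableI_vector by auto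
  have cancel: "1 / g * (g * s) = s" if "g > 0" for g s :: real
    using that by simp
  have "vector_derivative (rl_integral \<nu> p) (at x within {-1..1}) = ?D"
    by (rule vector_derivative_within_closed_interval[OF _ x D]) simp
  then show "rl_deriv \<nu> p x = (\<Sum>k<N. c k * (Gamma (\<nu> + real k + 1) / fact k) * (x + 1) ^ k)"
    unfolding rl_deriv_def using assms(2) by (simp only:) (intro cancel Gamma_real_pos, simp)
qed

section \<open>Jacobi polynomials expanded at $-1$\<close>

text \<open>Trinomial revision replaces \<open>(b gchoose s) * (s choose m)\<close> by
  \<open>(b gchoose m) * ((b - m) gchoose (s - m))\<close>; the remaining sum over \<open>s\<close>
  is a Vandermonde convolution.\<close>

lemma sum_gbinomial_trinomial:
  fixes a b :: real
  assumes "m \<le> n"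
  shows "(\<Sum>s\<le>n. (a gchoose (n - s)) * (b gchoose s) * real (s choose m)) =
         (b gchoose m) * ((a + b - real m) gchoose (n - m))"
proof -
  have "(\<Sum>s\<le>n. (a gchoose (n - s)) * (b gchoose s) * real (s choose m)) =
      (\<Sum>s=m..n. (a gchoose (n - s)) * (b gchoose s) * real (s choose m))"
    by (intro sum.mono_neutral_right) auto
  also have "\<dots> = (\<Sum>s=m..n. (b gchoose m) * ((b - real m) gchoose (s - m)) * (a gchoose (n - s)))"
  proof (intro sum.cong refl)
    fix s assume "s \<in> {m..n}"
    then have "(b gchoose s) * (real s gchoose m) = (b gchoose m) * ((b - real m) gchoose (s - m))"
      using gbinomial_trinomial_revision[of m s b] by simp
    then show "(a gchoose (n - s)) * (b gchoose s) * real (s choose m) =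
        (b gchoose m) * ((b - real m) gchoose (s - m)) * (a gchoose (n - s))"
      by (simp add: binomial_gbinomial mult_ac)
  qed
  also have "\<dots> = (\<Sum>i=0..n-m. (b gchoose m) * ((b - real m) gchoose i) * (a gchoose (n - m - i)))"
    by (rule sum.reindex_bij_witness[of _ "\<lambda>i. i + m" "\<lambda>s. s - m"]) (use assms in auto)
  also have "\<dots> = (b gchoose m) * ((b - real m + a) gchoose (n - m))"
    by (simp add: gbinomial_Vandermonde[symmetric] sum_distrib_left mult.assoc)
  finally show ?thesis by (simp add: algebra_simps)
qed

text \<open>With \<open>z = (x + 1) / 2\<close> the other factor is
  \<open>(x - 1) / 2 = z - 1\<close>. Expanding its powers binomially and collecting equal powers of
  \<open>z\<close> leaves the sums evaluated in \<open>sum_gbinomial_trinomial\<close>.\<close>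

lemma poly_jacobi_expand:
  "poly (jacobi \<alpha> \<beta> n) x =
     (\<Sum>k\<le>n. (-1) ^ (n - k) * ((real n + \<beta>) gchoose (n - k)) *
            ((real n + \<alpha> + \<beta> + real k) gchoose k) * ((x + 1) / 2) ^ k)"
proof -
  define z where "z = (x + 1) / 2"
  let ?A = "\<lambda>s. ((real n + \<alpha>) gchoose (n - s)) * ((real n + \<beta>) gchoose s)"
  have "poly (jacobi \<alpha> \<beta> n) x = (\<Sum>s\<le>n. ?A s * ((-1 + z) ^ s * z ^ (n - s)))"
    by (simp add: jacobi_def poly_sum z_def field_simps)
  also have "\<dots> = (\<Sum>s\<le>n. \<Sum>m\<le>n. ?A s * real (s choose m) * ((-1) ^ m * z ^ (n - m)))"
  proof (intro sum.cong refl)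
    fix s assume s: "s \<in> {..n}"
    have "(-1 + z) ^ s * z ^ (n - s) = (\<Sum>m\<le>s. real (s choose m) * (-1) ^ m * (z ^ (s - m) * z ^ (n - s)))"
      by (subst binomial_ring) (simp only: sum_distrib_right mult.assoc)
    also have "\<dots> = (\<Sum>m\<le>s. real (s choose m) * ((-1) ^ m * z ^ (n - m)))"
      using s by (intro sum.cong refl) (simp add: power_add[symmetric])
    also have "\<dots> = (\<Sum>m\<le>n. real (s choose m) * ((-1) ^ m * z ^ (n - m)))"
      using s by (intro sum.mono_neutral_left) auto
    finally show "?A s * ((-1 + z) ^ s * z ^ (n - s)) =
        (\<Sum>m\<le>n. ?A s * real (s choose m) * ((-1) ^ m * z ^ (n - m)))"
      by (simp add: sum_distrib_left mult_ac)
  qed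
  also have "\<dots> = (\<Sum>m\<le>n. (\<Sum>s\<le>n. ?A s * real (s choose m)) * ((-1) ^ m * z ^ (n - m)))"
    by (subst sum.swap) (simp add: sum_distrib_right)
  also have "\<dots> = (\<Sum>m\<le>n. ((real n + \<beta>) gchoose m) *
      ((real n + \<alpha> + (real n + \<beta>) - real m) gchoose (n - m)) * ((-1) ^ m * z ^ (n - m)))"
    by (intro sum.cong refl) (subst sum_gbinomial_trinomial, auto)
  \<comment> \<open>Reversal \<open>k = n - m\<close>, under which
    \<open>2 * n + \<alpha> + \<beta> - m\<close> becomes
    \<open>n + \<alpha> + \<beta> + k\<close>.\<close>
  also have "\<dots> = (\<Sum>k\<le>n. (-1) ^ (n - k) * ((real n + \<beta>) gchoose (n - k)) *
            ((real n + \<alpha> + \<beta> + real k) gchoose k) * z ^ k)"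
    by (rule sum.reindex_bij_witness[of _ "\<lambda>k. n - k" "\<lambda>m. n - m"])
       (auto simp: of_nat_diff algebra_simps)
  finally show ?thesis by (simp add: z_def)
qed

text \<open>The coefficient of \<open>(x + 1) ^ k\<close> in the Jacobi polynomial with parameters
  \<open>- \<nu>\<close> and \<open>\<nu>\<close>. Their sum is 0, so the second binomial is an
  integer one, free of \<open>\<nu>\<close>. The value 0 for \<open>k > n\<close> lets all degrees
  below \<open>N\<close> share one summation range.\<close>

definition jacobi_coeff :: "real \<Rightarrow> nat \<Rightarrow> nat \<Rightarrow> real" where
  "jacobi_coeff \<nu> n k = (if k \<le> n then
     (-1) ^ (n - k) * ((real n + \<nu>) gchoose (n - k)) * real ((n + k) choose k) / 2 ^ k else 0)"

lemma poly_jacobi_opposite: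
  assumes "n < N"
  shows "poly (jacobi (- \<nu>) \<nu> n) x = (\<Sum>k<N. jacobi_coeff \<nu> n k * (x + 1) ^ k)"
proof -
  have "poly (jacobi (- \<nu>) \<nu> n) x = (\<Sum>k\<le>n. jacobi_coeff \<nu> n k * (x + 1) ^ k)"
    unfolding poly_jacobi_expand jacobi_coeff_def
    by (intro sum.cong refl) (simp add: binomial_gbinomial power_divide)
  also have "\<dots> = (\<Sum>k<N. jacobi_coeff \<nu> n k * (x + 1) ^ k)"
    using assms by (intro sum.mono_neutral_left) (auto simp: jacobi_coeff_def)
  finally show ?thesis .
qed

text \<open>The parameter enters \<open>jacobi_coeff\<close> only through
  \<open>(n + \<nu>) gchoose (n - k)\<close>, whose denominator contains
  \<open>Gamma (\<nu> + k + 1)\<close>. The derivative weight cancels this, and what is left depends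
  on \<open>k\<close> as in the Legendre case \<open>\<nu> = 0\<close>.\<close>

lemma jacobi_coeff_legendre:
  assumes "0 < \<nu>"
  shows "jacobi_coeff \<nu> n k * (Gamma (\<nu> + real k + 1) / fact k) =
         Gamma (real (Suc n) + \<nu>) / Gamma (real (Suc n)) * jacobi_coeff 0 n k"
proof (cases "k \<le> n")
  case True
  have nz: "real n + \<nu> + 1 \<notin> \<int>\<^sub>\<le>\<^sub>0" using assms by (auto elim!: nonpos_Ints_cases)
  have pos: "Gamma (\<nu> + real k + 1) > 0" using assms by (intro Gamma_real_pos) auto
  have "((real n + \<nu>) gchoose (n - k)) * (Gamma (\<nu> + real k + 1) / fact k) =
      Gamma (real n + 1 + \<nu>) / (fact (n - k) * fact k)"
    using gbinomial_Gamma[OF nz, of "n - k"] True pos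
    by (simp add: of_nat_diff add_ac)
  also have "\<dots> = Gamma (real n + 1 + \<nu>) / fact n * real (n choose (n - k))"
    using binomial_fact[of "n - k" n, where 'a = real] True by simp
  also have "fact n = Gamma (real (Suc n))"
    using Gamma_fact[of n, where 'a = real] by (simp add: add_ac)
  finally have *: "((real n + \<nu>) gchoose (n - k)) * (Gamma (\<nu> + real k + 1) / fact k) =
      Gamma (real (Suc n) + \<nu>) / Gamma (real (Suc n)) * real (n choose (n - k))"
    by (simp add: add_ac)
  have "jacobi_coeff \<nu> n k * (Gamma (\<nu> + real k + 1) / fact k) =
      (-1) ^ (n - k) * real ((n + k) choose k) / 2 ^ k *
      (((real n + \<nu>) gchoose (n - k)) * (Gamma (\<nu> + real k + 1) / fact k))"
    using True by (simp add: jacobi_coeff_def)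
  then show ?thesis
    unfolding * using True by (simp add: jacobi_coeff_def binomial_gbinomial mult_ac)
qed (simp add: jacobi_coeff_def)

section \<open>Polynomial interpolation\<close>

text \<open>The top coefficient is removed with a multiple of \<open>P N\<close>. Bounding
  \<open>q\<close> by vanishing coefficients instead of a degree lets the induction start at
  \<open>N = 0\<close> with the zero polynomial.\<close>

lemma poly_in_graded_span:
  fixes P :: "nat \<Rightarrow> 'a::field poly"
  assumes "\<And>n. degree (P n) \<le> n" and "\<And>n. coeff (P n) n \<noteq> 0"
    and "\<And>i. i \<ge> N \<Longrightarrow> coeff q i = 0"
  shows "\<exists>c. q = (\<Sum>n<N. smult (c n) (P n))"
  using assms(3)
proof (induction N arbitrary: q)
  case 0
  then show ?case by (auto intro: poly_eqI)
next
  case (Suc N)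
  define b where "b = coeff q N / coeff (P N) N"
  have "coeff (q - smult b (P N)) i = 0" if "i \<ge> N" for i
  proof (cases "i = N")
    case True
    then show ?thesis using assms(2)[of N] by (simp add: b_def)
  next
    case False
    with that have "degree (P N) < i" using assms(1)[of N] by simp
    with False that Suc.prems show ?thesis by (simp add: coeff_eq_0)
  qed
  from Suc.IH[OF this] obtain c where c: "q - smult b (P N) = (\<Sum>n<N. smult (c n) (P n))"
    by blast
  have "q = (\<Sum>n<N. smult (c n) (P n)) + smult b (P N)"
    by (simp add: c[symmetric])
  also have "\<dots> = (\<Sum>n<Suc N. smult ((c(N := b)) n) (P n))"
    by simp
  finally show ?case by blast
qed

lemma degree_sum_power_le:
  fixes c :: "nat \<Rightarrow> 'a::comm_ring_1"
  shows "degree (\<Sum>k<N. smult (c k) ([:b, 1:] ^ k)) \<le> N - 1"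
proof (rule degree_sum_le)
  fix k assume "k \<in> {..<N}"
  then have "k \<le> N - 1" by auto
  moreover have "degree (smult (c k) ([:b, 1:] ^ k)) \<le> k"
    using degree_smult_le[of "c k" "[:b, 1:] ^ k"] degree_power_le[of "[:b, 1:]" k] by simp
  ultimately show "degree (smult (c k) ([:b, 1:] ^ k)) \<le> N - 1"
    by linarith
qed simp

text \<open>The top coefficient is \<open>jacobi_coeff 0 n n = (2 * n choose n) / 2 ^ n\<close>.
  These are the two conditions under which \<open>poly_in_graded_span\<close> applies to the
  Legendre polynomials.\<close>

lemma
  shows degree_legendre_le: "degree (legendre n) \<le> n"
    and coeff_legendre_neq_0: "coeff (legendre n) n \<noteq> 0"
proof -
  have eq: "legendre n = (\<Sum>k<Suc n. smult (jacobi_coeff 0 n k) ([:1, 1:] ^ k))"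
  proof (intro poly_eq_poly_eq_iff[THEN iffD1] ext)
    fix x :: real
    show "poly (legendre n) x = poly (\<Sum>k<Suc n. smult (jacobi_coeff 0 n k) ([:1, 1:] ^ k)) x"
      using poly_jacobi_opposite[of n "Suc n" 0 x]
      by (simp add: poly_sum add.commute del: sum.lessThan_Suc)
  qed
  show "degree (legendre n) \<le> n"
    unfolding eq using degree_sum_power_le[of "jacobi_coeff 0 n" 1 "Suc n"] by simp
  have "coeff ([:1, 1:] ^ k :: real poly) n = (if k = n then 1 else 0)" if "k \<le> n" for k
  proof (cases "k = n")
    case True
    then show ?thesis
      using lead_coeff_power[of "[:1, 1:] :: real poly" n] by (simp add: degree_power_eq)
  next
    case False
    with that show ?thesis by (intro trans[OF coeff_eq_0]) (auto simp: degree_power_eq)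
  qed
  then have "coeff (legendre n) n = (\<Sum>k<Suc n. jacobi_coeff 0 n k * (if k = n then 1 else 0))"
    unfolding eq coeff_sum coeff_smult by (intro sum.cong) auto
  also have "\<dots> = jacobi_coeff 0 n n" by simp
  finally show "coeff (legendre n) n \<noteq> 0"
    by (simp add: jacobi_coeff_def)
qed

text \<open>The classical Lagrange product; its Legendre expansions will supply the Birkhoff
  coefficients.\<close>

lemma lagrange_basis_exists:
  fixes y :: "'b \<Rightarrow> 'a::field"
  assumes "finite I" "inj_on y I" "j \<in> I"
  shows "\<exists>l. degree l \<le> card I - 1 \<and> (\<forall>i\<in>I. poly l (y i) = (if i = j then 1 else 0))"
proof -
  define l where "l = (\<Prod>m\<in>I - {j}. smult (1 / (y j - y m)) [:- y m, 1:])"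
  have "degree l \<le> (\<Sum>m\<in>I - {j}. (degree \<circ> (\<lambda>m. smult (1 / (y j - y m)) [:- y m, 1:])) m)"
    unfolding l_def using assms by (intro degree_prod_sum_le) auto
  also have "\<dots> \<le> (\<Sum>m\<in>I - {j}. 1)"
    by (intro sum_mono) auto
  also have "\<dots> = card I - 1" using assms by simp
  finally have deg: "degree l \<le> card I - 1" .
  have "poly l (y i) = (if i = j then 1 else 0)" if "i \<in> I" for i
  proof (cases "i = j")
    case True
    have "poly l (y j) = (\<Prod>m\<in>I - {j}. 1)"
      unfolding l_def poly_prod
    proof (intro prod.cong refl)
      fix m assume "m \<in> I - {j}"
      then have "y j - y m \<noteq> 0" using assms by (auto dest: inj_onD)
      then show "poly (smult (1 / (y j - y m)) [:- y m, 1:]) (y j) = 1"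
        by (simp add: diff_divide_distrib[symmetric])
    qed
    then show ?thesis using True by simp
  next
    case False
    have "\<exists>m\<in>I - {j}. poly (smult (1 / (y j - y m)) [:- y m, 1:]) (y i) = 0"
      using False that by (intro bexI[of _ i]) auto
    then show ?thesis
      using False assms by (simp add: l_def poly_prod prod_zero)
  qed
  with deg show ?thesis by blast
qed

text \<open>Polynomials of degree below \<open>N\<close> that agree at \<open>N\<close> points
  coincide. This carries the uniqueness of the interpolant.\<close>

lemma power_sum_coeffs_unique:
  fixes f g :: "nat \<Rightarrow> 'a::idom"
  assumes eq: "\<And>t. t \<in> A \<Longrightarrow> (\<Sum>k<N. f k * t ^ k) = (\<Sum>k<N. g k * t ^ k)"
    and A: "card A = N" and k: "k < N"
  shows "f k = g k"
proof -
  have deg: "degree (\<Sum>k<N. monom (h k) k) < card A" for h :: "nat \<Rightarrow> 'a"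
  proof -
    have "degree (\<Sum>k<N. monom (h k) k) \<le> N - 1"
      by (rule degree_sum_le) (auto intro: le_trans[OF degree_monom_le])
    with A k show ?thesis by simp
  qed
  have "(\<Sum>k<N. monom (f k) k) = (\<Sum>k<N. monom (g k) k)"
    by (rule poly_eqI_degree[of A]) (simp_all add: deg poly_sum poly_monom eq)
  then have "coeff (\<Sum>k<N. monom (f k) k) k = coeff (\<Sum>k<N. monom (g k) k) k"
    by simp
  with k show ?thesis by (simp add: coeff_sum)
qed

section \<open>The Birkhoff interpolant\<close>

text \<open>Column \<open>j\<close> of the coefficients is the Legendre expansion of the
  \<open>j\<close>-th Lagrange polynomial, rescaled by the nonzero Gamma quotients.\<close>

lemma birkhoff_coeffs_exist:
  assumes "0 < \<nu>" and inj: "inj_on y {1..N}"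
  shows "\<exists>a. birkhoff_coeffs \<nu> N y a"
proof -
  have "\<exists>c. \<forall>i\<in>{1..N}. (\<Sum>n<N. c n * poly (legendre n) (y i)) = (if i = j then 1 else 0)"
    if j: "j \<in> {1..N}" for j
  proof -
    obtain l where l: "degree l \<le> N - 1"
        "\<And>i. i \<in> {1..N} \<Longrightarrow> poly l (y i) = (if i = j then 1 else 0)"
      using lagrange_basis_exists[OF _ inj j] by auto
    have "coeff l i = 0" if "i \<ge> N" for i
      using l(1) that j by (intro coeff_eq_0) auto
    from poly_in_graded_span[of legendre, OF degree_legendre_le coeff_legendre_neq_0 this]
    obtain c where "l = (\<Sum>n<N. smult (c n) (legendre n))" by blast
    with l(2) show ?thesis by (intro exI[of _ c]) (simp add: poly_sum)
  qed
  then obtain c where c: "\<And>j i. j \<in> {1..N} \<Longrightarrow> i \<in> {1..N} \<Longrightarrow>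
      (\<Sum>n<N. c j n * poly (legendre n) (y i)) = (if i = j then 1 else 0)"
    by metis
  define a where "a n j = c j (n - 1) / (Gamma (real n + \<nu>) / Gamma (real n))" for n j
  have "(\<Sum>n=1..N. a n j * (Gamma (real n + \<nu>) / Gamma (real n)) * poly (legendre (n - 1)) (y i))
      = (if i = j then 1 else 0)" if ij: "i \<in> {1..N}" "j \<in> {1..N}" for i j
  proof -
    have "(\<Sum>n=1..N. a n j * (Gamma (real n + \<nu>) / Gamma (real n)) * poly (legendre (n - 1)) (y i))
        = (\<Sum>n=1..N. c j (n - 1) * poly (legendre (n - 1)) (y i))"
    proof (intro sum.cong refl)
      fix n assume "n \<in> {1..N}"
      then have "Gamma (real n) > 0" "Gamma (real n + \<nu>) > 0"
        using assms(1) by (auto intro!: Gamma_real_pos)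
      then show "a n j * (Gamma (real n + \<nu>) / Gamma (real n)) * poly (legendre (n - 1)) (y i) =
          c j (n - 1) * poly (legendre (n - 1)) (y i)"
        by (simp add: a_def)
    qed
    also have "\<dots> = (\<Sum>n<N. c j n * poly (legendre n) (y i))"
      by (rule sum.reindex_bij_witness[of _ Suc "\<lambda>n. n - 1"]) auto
    finally show ?thesis using c[OF ij(2,1)] by simp
  qed
  then show ?thesis unfolding birkhoff_coeffs_def by blast
qed

definition basis_coeff :: "real \<Rightarrow> nat \<Rightarrow> (nat \<Rightarrow> nat \<Rightarrow> real) \<Rightarrow> nat \<Rightarrow> nat \<Rightarrow> real" where
  "basis_coeff \<nu> N a j k = (\<Sum>n=1..N. a n j * jacobi_coeff \<nu> (n - 1) k)"

lemma birkhoff_basis_eq: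
  "birkhoff_basis \<nu> N a j x = (x + 1) powr \<nu> * (\<Sum>k<N. basis_coeff \<nu> N a j k * (x + 1) ^ k)"
proof -
  have "(\<Sum>n=1..N. a n j * poly (jacobi (- \<nu>) \<nu> (n - 1)) x) =
      (\<Sum>n=1..N. \<Sum>k<N. a n j * jacobi_coeff \<nu> (n - 1) k * (x + 1) ^ k)"
    by (intro sum.cong refl, subst poly_jacobi_opposite[of _ N])
       (auto simp: sum_distrib_left mult.assoc)
  also have "\<dots> = (\<Sum>k<N. basis_coeff \<nu> N a j k * (x + 1) ^ k)"
    by (subst sum.swap) (simp add: basis_coeff_def sum_distrib_right)
  finally show ?thesis by (simp add: birkhoff_basis_def)
qed

text \<open>For \<open>x\<close> in \<open>{-1..1}\<close> the left side is the fractional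
  derivative of \<open>birkhoff_basis \<nu> N a j\<close> at \<open>x\<close>, by
  \<open>rl_deriv_frac_poly\<close>. At a node \<open>y i\<close> the right side is the expression
  that \<open>birkhoff_coeffs\<close> sets to the Kronecker delta.\<close>

lemma basis_coeff_deriv:
  assumes "0 < \<nu>"
  shows "(\<Sum>k<N. basis_coeff \<nu> N a j k * (Gamma (\<nu> + real k + 1) / fact k) * (x + 1) ^ k) =
    (\<Sum>n=1..N. a n j * (Gamma (real n + \<nu>) / Gamma (real n)) * poly (legendre (n - 1)) x)"
proof -
  have "(\<Sum>k<N. basis_coeff \<nu> N a j k * (Gamma (\<nu> + real k + 1) / fact k) * (x + 1) ^ k) =
      (\<Sum>k<N. \<Sum>n=1..N.
        a n j * (jacobi_coeff \<nu> (n - 1) k * (Gamma (\<nu> + real k + 1) / fact k)) * (x + 1) ^ k)"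
    unfolding basis_coeff_def sum_distrib_right mult.assoc ..
  also have "\<dots> = (\<Sum>n=1..N. \<Sum>k<N.
        a n j * (jacobi_coeff \<nu> (n - 1) k * (Gamma (\<nu> + real k + 1) / fact k)) * (x + 1) ^ k)"
    by (rule sum.swap)
  also have "\<dots> = (\<Sum>n=1..N.
      a n j * (Gamma (real n + \<nu>) / Gamma (real n)) * poly (legendre (n - 1)) x)"
  proof (intro sum.cong refl)
    fix n assume "n \<in> {1..N}"
    then obtain m where n: "n = Suc m" "m < N" by (cases n) auto
    show "(\<Sum>k<N. a n j * (jacobi_coeff \<nu> (n - 1) k * (Gamma (\<nu> + real k + 1) / fact k)) *
        (x + 1) ^ k) = a n j * (Gamma (real n + \<nu>) / Gamma (real n)) * poly (legendre (n - 1)) x"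
      using poly_jacobi_opposite[OF n(2), of 0 x]
      unfolding n(1) diff_Suc_1 jacobi_coeff_legendre[OF assms]
      by (simp add: sum_distrib_left sum_divide_distrib mult_ac)
  qed
  finally show ?thesis .
qed

text \<open>The equivalence says both that the combination solves the problem and that every
  solution agrees with it on \<open>{-1..1}\<close>. The existence of coefficients keeps it from
  being vacuous.\<close>

theorem theorem3p1:
  fixes \<nu> :: real and N :: nat and y :: "nat \<Rightarrow> real" and u :: "real \<Rightarrow> real"
  assumes "0 < \<nu>" and "\<nu> < 1"
    and "N \<ge> 1"
    and "-1 < y 1" and "strict_mono_on {1..N} y" and "y N \<le> 1"
    and "u (-1) = 0"
    and "\<And>j. j \<in> {1..N} \<Longrightarrow> rl_differentiable \<nu> u (y j)"
  shows "(\<exists>a. birkhoff_coeffs \<nu> N y a) \<and>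
         (\<forall>a. birkhoff_coeffs \<nu> N y a \<longrightarrow>
           (\<forall>p. is_rl_interpolant \<nu> N y u p \<longleftrightarrow>
             (\<forall>x\<in>{-1..1}. p x = (\<Sum>j=1..N. rl_deriv \<nu> u (y j) * birkhoff_basis \<nu> N a j x))))"
proof (intro conjI allI impI)
  have inj: "inj_on y {1..N}"
    using assms(5) by (rule strict_mono_on_imp_inj_on)
  have mono: "y i \<le> y j" if "i \<in> {1..N}" "j \<in> {1..N}" "i \<le> j" for i j
    using strict_mono_on_leD[OF assms(5) that] .
  have y: "y i \<in> {-1..1}" if "i \<in> {1..N}" for i
    using mono[of 1 i] mono[of i N] that assms(3,4,6) by auto
  show "\<exists>a. birkhoff_coeffs \<nu> N y a"
    using birkhoff_coeffs_exist[OF assms(1) inj] .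
  fix a p
  assume a: "birkhoff_coeffs \<nu> N y a"
  define d where "d j = rl_deriv \<nu> u (y j)" for j
  \<comment> \<open>The claimed interpolant, divided by \<open>(x + 1) powr \<nu>\<close>, has the
    coefficients \<open>e\<close> in powers of \<open>x + 1\<close>; \<open>w\<close> below holds
    the diagonal entries of the fractional derivative.\<close>
  define e where "e k = (\<Sum>j=1..N. d j * basis_coeff \<nu> N a j k)" for k
  define w where "w k = Gamma (\<nu> + real k + 1) / fact k" for k
  have w: "w k > 0" for k
    unfolding w_def using assms(1) by (intro divide_pos_pos Gamma_real_pos) auto
  have S: "(\<Sum>j=1..N. d j * birkhoff_basis \<nu> N a j x) =
      (x + 1) powr \<nu> * (\<Sum>k<N. e k * (x + 1) ^ k)" for x
  proof -
    define X where "X j = (\<Sum>k<N. basis_coeff \<nu> N a j k * (x + 1) ^ k)" for j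
    have "(\<Sum>k<N. e k * (x + 1) ^ k) = (\<Sum>j=1..N. d j * X j)"
      unfolding e_def X_def sum_distrib_right sum_distrib_left mult.assoc by (rule sum.swap)
    moreover have "birkhoff_basis \<nu> N a j x = (x + 1) powr \<nu> * X j" for j
      unfolding X_def by (rule birkhoff_basis_eq)
    ultimately show ?thesis
      by (simp add: sum_distrib_left mult_ac)
  qed
  have e: "(\<Sum>k<N. e k * w k * (y i + 1) ^ k) = d i" if i: "i \<in> {1..N}" for i
  proof -
    have "(\<Sum>k<N. e k * w k * (y i + 1) ^ k) =
        (\<Sum>j=1..N. d j * (\<Sum>k<N. basis_coeff \<nu> N a j k * w k * (y i + 1) ^ k))"
      unfolding e_def sum_distrib_right sum_distrib_left mult.assoc by (rule sum.swap)
    also have "\<dots> = (\<Sum>j=1..N. d j * (if i = j then 1 else 0))"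
      using a i unfolding w_def basis_coeff_deriv[OF assms(1)] birkhoff_coeffs_def
      by (intro sum.cong) auto
    also have "\<dots> = (\<Sum>j=1..N. if i = j then d j else 0)"
      by (intro sum.cong) auto
    also have "\<dots> = d i" using i by simp
    finally show ?thesis .
  qed
  show "is_rl_interpolant \<nu> N y u p \<longleftrightarrow>
      (\<forall>x\<in>{-1..1}. p x = (\<Sum>j=1..N. rl_deriv \<nu> u (y j) * birkhoff_basis \<nu> N a j x))"
    unfolding d_def[symmetric] S
  proof
    assume p: "\<forall>x\<in>{-1..1}. p x = (x + 1) powr \<nu> * (\<Sum>k<N. e k * (x + 1) ^ k)"
    define q where "q = (\<Sum>k<N. smult (e k) ([:1, 1:] ^ k))"
    have "poly q x = (\<Sum>k<N. e k * (x + 1) ^ k)" for x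
      by (simp add: q_def poly_sum add.commute)
    with p have "p \<in> frac_poly_space \<nu> N"
      unfolding frac_poly_space_def
      using degree_sum_power_le[of e 1 N] by (auto simp: q_def[symmetric])
    moreover have "rl_differentiable \<nu> p (y j) \<and> rl_deriv \<nu> p (y j) = rl_deriv \<nu> u (y j)"
      if j: "j \<in> {1..N}" for j
    proof -
      note D = rl_deriv_frac_poly[OF assms(1,2) y[OF j] p[rule_format]]
      show ?thesis
        using D(1) D(2)[folded w_def] e[OF j] by (simp only: d_def)
    qed
    ultimately show "is_rl_interpolant \<nu> N y u p"
      by (simp add: is_rl_interpolant_def)
  next
    assume "is_rl_interpolant \<nu> N y u p"
    then obtain q where q: "degree q \<le> N - 1"
        "\<And>x. x \<in> {-1..1} \<Longrightarrow> p x = (x + 1) powr \<nu> * poly q x"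
      and p: "\<And>j. j \<in> {1..N} \<Longrightarrow> rl_deriv \<nu> p (y j) = d j"
      unfolding is_rl_interpolant_def frac_poly_space_def d_def by blast
    \<comment> \<open>The shift \<open>r t = q (t - 1)\<close> rewrites \<open>q\<close> in powers
      of \<open>x + 1\<close>.\<close>
    define r where "r = q \<circ>\<^sub>p [:-1, 1:]"
    define c where "c = coeff r"
    have "degree r < N" using q(1) assms(3) by (simp add: r_def degree_pcompose)
    then have r: "poly r t = (\<Sum>k<N. c k * t ^ k)" for t
      unfolding poly_altdef c_def by (intro sum.mono_neutral_left) (auto simp: coeff_eq_0)
    have "poly q x = poly r (x + 1)" for x
      by (simp add: r_def poly_pcompose)
    with q(2) r have pc: "p x = (x + 1) powr \<nu> * (\<Sum>k<N. c k * (x + 1) ^ k)"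
      if "x \<in> {-1..1}" for x using that by simp
    \<comment> \<open>The weighted sums are the fractional derivatives of \<open>p\<close> and of
      the claimed interpolant; they agree at the \<open>N\<close> distinct points
      \<open>y i + 1\<close>. The positive weights can then be cancelled.\<close>
    have "c k * w k = e k * w k" if "k < N" for k
    proof (rule power_sum_coeffs_unique
        [where f = "\<lambda>k. c k * w k" and g = "\<lambda>k. e k * w k", OF _ _ that])
      have "inj_on (\<lambda>i. y i + 1) {1..N}"
        using inj by (intro inj_onI) (simp only: add_right_cancel inj_onD)
      then show "card ((\<lambda>i. y i + 1) ` {1..N}) = N"
        by (simp add: card_image)
      show "(\<Sum>k<N. c k * w k * t ^ k) = (\<Sum>k<N. e k * w k * t ^ k)"
        if "t \<in> (\<lambda>i. y i + 1) ` {1..N}" for t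
      proof -
        from that obtain i where i: "i \<in> {1..N}" "t = y i + 1" by blast
        have "(\<Sum>k<N. c k * w k * t ^ k) = rl_deriv \<nu> p (y i)"
          unfolding w_def i(2) by (rule rl_deriv_frac_poly(2)[OF assms(1,2) y[OF i(1)] pc, symmetric])
        also have "\<dots> = (\<Sum>k<N. e k * w k * t ^ k)"
          unfolding i(2) e[OF i(1)] by (rule p[OF i(1)])
        finally show ?thesis .
      qed
    qed
    then have "c k = e k" if "k < N" for k
      using w[of k] that by (metis less_irrefl mult_right_cancel)
    then show "\<forall>x\<in>{-1..1}. p x = (x + 1) powr \<nu> * (\<Sum>k<N. e k * (x + 1) ^ k)"
      using pc by simp
  qed
qed

end
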